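(* Let $k$ be a field, let $\mathbf{\Lambda}=\{\Lambda_n^i \mid n\geq 1,\ 0\leq i\leq n\}$ be a $\Delta$-indexing set, and let $\mathcal{M}=(M_n,d_i^\alpha)$ be a $\mathbf{\Lambda}$-system of $k$-vector spaces. Then $\mathcal{M}$ has a unique maximal $\lambda$-subcomplex (maximal with respect to the partial order of degreewise inclusion on $\lambda$-subcomplexes of $\mathcal{M}$). In particular, there is a unique maximal pre-simplicial $k$-module in $\mathcal{M}$, denoted $\Theta(\mathcal{M})$, namely this maximal $\lambda$-subcomplex with its induced maps $d_i$.
   Context: Throughout, $k$ is a field and all maps are $k$-linear. A pre-simplicial $k$-module is a sequence of $k$-vector spaces $(X_n)_{n\ge 0}$ with $k$-linear maps $\delta_i:X_n\to X_{n-1}$ for $n\geq 1$, $0\le i\le n$, satisfying $\delta_i\delta_j=\delta_{j-1}\delta_i$ for $i<j$ (as maps $X_n\to X_{n-2}$, $n\ge 2$, $0\le i<j\le n$). A $\Delta$-indexing set is a collection $\mathbf{\Lambda}=\{\Lambda_n^i \mid n\geq 1,\ 0\leq i\leq n\}$ of nonempty finite sets. A $\mathbf{\Lambda}$-system $\mathcal{M}=(M_n,d_i^\alpha)$ consists of $k$-vector spaces $\{M_n\}_{n\ge 0}$ and, for every $n\geq 1$, $0\le i\le n$ and $\alpha\in\Lambda_n^i$, a $k$-linear map $d_i^\alpha:M_n\to M_{n-1}$ (no relations among these maps are required). A $\lambda$-subcomplex of $\mathcal{M}$ is a sequence $A_\bullet=(A_n)_{n\ge 0}$ with each $A_n$ a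 $k$-subspace of $M_n$ such that: (i) for all $n\ge 1$, $0\le i\le n$ and $\alpha,\beta\in\Lambda_n^i$, $d_i^\alpha|_{A_n}=d_i^\beta|_{A_n}$; this common restriction is denoted $d_i^A$; (ii) $d_i^A(A_n)\subseteq A_{n-1}$ for all $n\ge1$, $0\le i\le n$; (iii) $d_i^A d_j^A=d_{j-1}^A d_i^A$ on $A_n$ for all $n\geq 2$ and $0\le i<j\le n$. Thus $(A_n,d_i^A)$ is a pre-simplicial $k$-module. The set of $\lambda$-subcomplexes of $\mathcal{M}$ is partially ordered by: $A_\bullet\le B_\bullet$ if and only if $A_n\subseteq B_n$ for all $n\ge 0$. *)

theory Defs
  imports "Jordan_Normal_Form.Missing_VectorSpace" "HOL-Library.FuncSet"
begin

text \<open>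
  Vector spaces are carrier-based records, so the spaces of a graded family \<open>M n\<close> share an
  underlying type but may have different carriers and different operations. Families indexed by
  \<open>n \<ge> 1\<close> and \<open>0 \<le> i \<le> n\<close> are total functions of \<open>n\<close> and \<open>i\<close> whose values elsewhere are never used.
  The names \<open>subspace\<close> and \<open>linear_map\<close> are qualified because the real-vector-space library has
  constants with similar names.
\<close>

locale pre_simplicial_module =
  fixes K :: "('a, 'r) ring_scheme"
    and X :: "nat \<Rightarrow> ('a, 'b, 'm) module_scheme"
    and \<delta> :: "nat \<Rightarrow> nat \<Rightarrow> 'b \<Rightarrow> 'b"
  assumes space: "\<And>n. vectorspace K (X n)"
    and face: "\<And>n i. 1 \<le> n \<Longrightarrow> i \<le> n \<Longrightarrow>
      VectorSpace.linear_map K (X n) (X (n - 1)) (\<delta> n i)"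
    and simplicial: "\<And>n i j x. 2 \<le> n \<Longrightarrow> i < j \<Longrightarrow> j \<le> n \<Longrightarrow> x \<in> carrier (X n) \<Longrightarrow>
      \<delta> (n - 1) i (\<delta> n j x) = \<delta> (n - 1) (j - 1) (\<delta> n i x)"

locale Delta_indexing_set =
  fixes \<Lambda> :: "nat \<Rightarrow> nat \<Rightarrow> 'i set"
  assumes index_finite: "\<And>n i. 1 \<le> n \<Longrightarrow> i \<le> n \<Longrightarrow> finite (\<Lambda> n i)"
    and index_nonempty: "\<And>n i. 1 \<le> n \<Longrightarrow> i \<le> n \<Longrightarrow> \<Lambda> n i \<noteq> {}"

locale Lambda_system = Delta_indexing_set \<Lambda>
  for K :: "('a, 'r) ring_scheme"
    and \<Lambda> :: "nat \<Rightarrow> nat \<Rightarrow> 'i set"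
    and M :: "nat \<Rightarrow> ('a, 'b, 'm) module_scheme"
    and d :: "nat \<Rightarrow> nat \<Rightarrow> 'i \<Rightarrow> 'b \<Rightarrow> 'b" +
  assumes space: "\<And>n. vectorspace K (M n)"
    and face: "\<And>n i \<alpha>. 1 \<le> n \<Longrightarrow> i \<le> n \<Longrightarrow> \<alpha> \<in> \<Lambda> n i \<Longrightarrow>
      VectorSpace.linear_map K (M n) (M (n - 1)) (d n i \<alpha>)"

definition faces_agree ::
  "(nat \<Rightarrow> nat \<Rightarrow> 'i set) \<Rightarrow> (nat \<Rightarrow> nat \<Rightarrow> 'i \<Rightarrow> 'b \<Rightarrow> 'b) \<Rightarrow> (nat \<Rightarrow> 'b set) \<Rightarrow> bool" where
  "faces_agree \<Lambda> d A \<longleftrightarrow>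
    (\<forall>n i. 1 \<le> n \<longrightarrow> i \<le> n \<longrightarrow>
      (\<forall>\<alpha>\<in>\<Lambda> n i. \<forall>\<beta>\<in>\<Lambda> n i. restrict (d n i \<alpha>) (A n) = restrict (d n i \<beta>) (A n)))"

text \<open>
  The common restriction of the maps \<open>d n i \<alpha>\<close> to \<open>A n\<close>, meaningful if \<open>faces_agree\<close> holds.
  It is set to \<open>undefined\<close> outside \<open>A n\<close> and at unused indices, so that equality of families of
  face maps is equality as maps on the subspaces.
\<close>
definition induced_face ::
  "(nat \<Rightarrow> nat \<Rightarrow> 'i set) \<Rightarrow> (nat \<Rightarrow> nat \<Rightarrow> 'i \<Rightarrow> 'b \<Rightarrow> 'b) \<Rightarrow> (nat \<Rightarrow> 'b set)
    \<Rightarrow> nat \<Rightarrow> nat \<Rightarrow> 'b \<Rightarrow> 'b" where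
  "induced_face \<Lambda> d A n i =
    (if 1 \<le> n \<and> i \<le> n then THE f. \<forall>\<alpha>\<in>\<Lambda> n i. f = restrict (d n i \<alpha>) (A n)
     else (\<lambda>x. undefined))"

definition lambda_subcomplex ::
  "('a, 'r) ring_scheme \<Rightarrow> (nat \<Rightarrow> nat \<Rightarrow> 'i set) \<Rightarrow> (nat \<Rightarrow> ('a, 'b, 'm) module_scheme)
    \<Rightarrow> (nat \<Rightarrow> nat \<Rightarrow> 'i \<Rightarrow> 'b \<Rightarrow> 'b) \<Rightarrow> (nat \<Rightarrow> 'b set) \<Rightarrow> bool" where
  "lambda_subcomplex K \<Lambda> M d A \<longleftrightarrow>
    (\<forall>n. VectorSpace.subspace K (A n) (M n)) \<and>
    faces_agree \<Lambda> d A \<and>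
    (\<forall>n i. 1 \<le> n \<longrightarrow> i \<le> n \<longrightarrow> induced_face \<Lambda> d A n i ` A n \<subseteq> A (n - 1)) \<and>
    (\<forall>n i j. 2 \<le> n \<longrightarrow> i < j \<longrightarrow> j \<le> n \<longrightarrow>
      (\<forall>x\<in>A n. induced_face \<Lambda> d A (n - 1) i (induced_face \<Lambda> d A n j x) =
               induced_face \<Lambda> d A (n - 1) (j - 1) (induced_face \<Lambda> d A n i x)))"

text \<open>The pointwise order \<open>\<le>\<close> on \<^typ>\<open>nat \<Rightarrow> 'b set\<close> is degreewise inclusion.\<close>
definition maximal_lambda_subcomplex ::
  "('a, 'r) ring_scheme \<Rightarrow> (nat \<Rightarrow> nat \<Rightarrow> 'i set) \<Rightarrow> (nat \<Rightarrow> ('a, 'b, 'm) module_scheme)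
    \<Rightarrow> (nat \<Rightarrow> nat \<Rightarrow> 'i \<Rightarrow> 'b \<Rightarrow> 'b) \<Rightarrow> (nat \<Rightarrow> 'b set) \<Rightarrow> bool" where
  "maximal_lambda_subcomplex K \<Lambda> M d A \<longleftrightarrow>
    lambda_subcomplex K \<Lambda> M d A \<and>
    (\<forall>B. lambda_subcomplex K \<Lambda> M d B \<longrightarrow> A \<le> B \<longrightarrow> B = A)"

text \<open>
  A pre-simplicial module \<open>(X, \<delta>)\<close> lies in the system if its spaces are subspaces of the \<open>M n\<close>
  and every \<open>d n i \<alpha>\<close> restricts to \<open>\<delta> n i\<close>. The condition on unused indices only normalises
  the representation of \<open>\<delta>\<close>, as in \<open>induced_face\<close>.
\<close>
definition pre_simplicial_in ::
  "('a, 'r) ring_scheme \<Rightarrow> (nat \<Rightarrow> nat \<Rightarrow> 'i set) \<Rightarrow> (nat \<Rightarrow> ('a, 'b, 'm) module_scheme)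
    \<Rightarrow> (nat \<Rightarrow> nat \<Rightarrow> 'i \<Rightarrow> 'b \<Rightarrow> 'b)
    \<Rightarrow> (nat \<Rightarrow> 'b set) \<times> (nat \<Rightarrow> nat \<Rightarrow> 'b \<Rightarrow> 'b) \<Rightarrow> bool" where
  "pre_simplicial_in K \<Lambda> M d = (\<lambda>(X, \<delta>).
    (\<forall>n. VectorSpace.subspace K (X n) (M n)) \<and>
    pre_simplicial_module K (\<lambda>n. (M n)\<lparr>carrier := X n\<rparr>) \<delta> \<and>
    (\<forall>n i. 1 \<le> n \<longrightarrow> i \<le> n \<longrightarrow> (\<forall>\<alpha>\<in>\<Lambda> n i. \<delta> n i = restrict (d n i \<alpha>) (X n))) \<and>
    (\<forall>n i. \<not> (1 \<le> n \<and> i \<le> n) \<longrightarrow> \<delta> n i = (\<lambda>x. undefined)))"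

definition sub_pre_simplicial ::
  "(nat \<Rightarrow> 'b set) \<times> (nat \<Rightarrow> nat \<Rightarrow> 'b \<Rightarrow> 'b) \<Rightarrow> (nat \<Rightarrow> 'b set) \<times> (nat \<Rightarrow> nat \<Rightarrow> 'b \<Rightarrow> 'b) \<Rightarrow> bool" where
  "sub_pre_simplicial = (\<lambda>(X, \<delta>) (Y, \<epsilon>).
    X \<le> Y \<and> (\<forall>n i. 1 \<le> n \<longrightarrow> i \<le> n \<longrightarrow> (\<forall>x\<in>X n. \<delta> n i x = \<epsilon> n i x)))"

definition maximal_pre_simplicial_in ::
  "('a, 'r) ring_scheme \<Rightarrow> (nat \<Rightarrow> nat \<Rightarrow> 'i set) \<Rightarrow> (nat \<Rightarrow> ('a, 'b, 'm) module_scheme)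
    \<Rightarrow> (nat \<Rightarrow> nat \<Rightarrow> 'i \<Rightarrow> 'b \<Rightarrow> 'b)
    \<Rightarrow> (nat \<Rightarrow> 'b set) \<times> (nat \<Rightarrow> nat \<Rightarrow> 'b \<Rightarrow> 'b) \<Rightarrow> bool" where
  "maximal_pre_simplicial_in K \<Lambda> M d P \<longleftrightarrow>
    pre_simplicial_in K \<Lambda> M d P \<and>
    (\<forall>Q. pre_simplicial_in K \<Lambda> M d Q \<longrightarrow> sub_pre_simplicial P Q \<longrightarrow> Q = P)"

definition Theta ::
  "('a, 'r) ring_scheme \<Rightarrow> (nat \<Rightarrow> nat \<Rightarrow> 'i set) \<Rightarrow> (nat \<Rightarrow> ('a, 'b, 'm) module_scheme)
    \<Rightarrow> (nat \<Rightarrow> nat \<Rightarrow> 'i \<Rightarrow> 'b \<Rightarrow> 'b)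
    \<Rightarrow> (nat \<Rightarrow> 'b set) \<times> (nat \<Rightarrow> nat \<Rightarrow> 'b \<Rightarrow> 'b)" where
  "Theta K \<Lambda> M d = (THE P. maximal_pre_simplicial_in K \<Lambda> M d P)"

end

theory Submission
  imports Defs
begin

text \<open>
  A \<open>\<lambda>\<close>-subcomplex is a family of subspaces whose elements satisfy linear equations (the maps
  with different labels agree, and the simplicial identities hold) and whose face maps stay in the
  family. Since a face map lowers the degree by exactly one, the stability condition in degree
  \<open>n + 1\<close> only refers to degree \<open>n\<close>. So the largest candidate can be written down by recursion:
  it is everything in degree \<open>0\<close>, and in degree \<open>n + 1\<close> it consists of all elements that satisfy
  the equations and have all their faces in the degree \<open>n\<close> part (\<open>largest\<close>).

  Each degree is a subspace because the defining conditions are equalizers and preimages of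
  subspaces under linear maps (\<open>subspace_largest\<close>), and an induction on the degree shows that
  every \<open>\<lambda>\<close>-subcomplex lies in this one (\<open>lambda_subcomplex_le_largest\<close>). A greatest element is
  the unique maximal one.

  For pre-simplicial modules in the system, the face maps are forced by the spaces: the passage
  \<open>A \<mapsto> (A, induced_face \<Lambda> d A)\<close> identifies \<open>\<lambda>\<close>-subcomplexes with pre-simplicial modules in the
  system (\<open>pre_simplicial_in_iff\<close>) and preserves inclusions, so the greatest element is
  transported to a greatest pre-simplicial module.
\<close>

section \<open>Restriction of linear maps and induced faces\<close>

lemma subspace_carrier:
  assumes "vectorspace K V"
  shows "VectorSpace.subspace K (carrier V) V"
proof -
  interpret vectorspace K V by fact
  show ?thesis
    by unfold_locales auto
qed

text \<open>
  A map with values in a subspace is linear into the subspace as soon as it is linear into the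
  ambient space, since the operations are the ambient ones.
\<close>
lemma linear_map_restrict:
  assumes f: "VectorSpace.linear_map K V W f"
    and A: "VectorSpace.subspace K A V" and B: "VectorSpace.subspace K B W"
    and im: "\<And>x. x \<in> A \<Longrightarrow> f x \<in> B"
  shows "VectorSpace.linear_map K (V\<lparr>carrier := A\<rparr>) (W\<lparr>carrier := B\<rparr>) (restrict f A)"
proof -
  interpret f: VectorSpace.linear_map K V W f by fact
  interpret A: LinearCombinations.submodule K A V
    using A by (simp add: VectorSpace.subspace_def)
  interpret A': vectorspace K "V\<lparr>carrier := A\<rparr>"
    using f.V.subspace_is_vs[OF A] .
  interpret B': vectorspace K "W\<lparr>carrier := B\<rparr>"
    using f.W.subspace_is_vs[OF B] .
  have "restrict f A \<in> module_hom K (V\<lparr>carrier := A\<rparr>) (W\<lparr>carrier := B\<rparr>)"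
    using A.subset im by (auto simp: module_hom_def subset_iff)
  then show ?thesis
    by unfold_locales
qed

lemma induced_face_eq:
  assumes "1 \<le> n" "i \<le> n" "\<alpha> \<in> \<Lambda> n i"
    and "\<And>\<beta>. \<beta> \<in> \<Lambda> n i \<Longrightarrow> restrict (d n i \<beta>) (A n) = f"
  shows "induced_face \<Lambda> d A n i = f"
  unfolding induced_face_def using assms by auto

context Lambda_system
begin

lemma face_closed:
  assumes "1 \<le> n" "i \<le> n" "\<alpha> \<in> \<Lambda> n i" "x \<in> carrier (M n)"
  shows "d n i \<alpha> x \<in> carrier (M (n - 1))"
proof -
  interpret VectorSpace.linear_map K "M n" "M (n - 1)" "d n i \<alpha>"
    using face assms by blast
  show ?thesis using f_im[OF assms(4)] .
qed

lemma face_zero: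
  assumes "1 \<le> n" "i \<le> n" "\<alpha> \<in> \<Lambda> n i"
  shows "d n i \<alpha> \<zero>\<^bsub>M n\<^esub> = \<zero>\<^bsub>M (n - 1)\<^esub>"
proof -
  interpret VectorSpace.linear_map K "M n" "M (n - 1)" "d n i \<alpha>"
    using face assms by blast
  show ?thesis by simp
qed

lemma face_add:
  assumes "1 \<le> n" "i \<le> n" "\<alpha> \<in> \<Lambda> n i" "x \<in> carrier (M n)" "y \<in> carrier (M n)"
  shows "d n i \<alpha> (x \<oplus>\<^bsub>M n\<^esub> y) = d n i \<alpha> x \<oplus>\<^bsub>M (n - 1)\<^esub> d n i \<alpha> y"
proof -
  interpret VectorSpace.linear_map K "M n" "M (n - 1)" "d n i \<alpha>"
    using face assms by blast
  show ?thesis using assms(4,5) by simp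
qed

lemma face_smult:
  assumes "1 \<le> n" "i \<le> n" "\<alpha> \<in> \<Lambda> n i" "c \<in> carrier K" "x \<in> carrier (M n)"
  shows "d n i \<alpha> (c \<odot>\<^bsub>M n\<^esub> x) = c \<odot>\<^bsub>M (n - 1)\<^esub> d n i \<alpha> x"
proof -
  interpret VectorSpace.linear_map K "M n" "M (n - 1)" "d n i \<alpha>"
    using face assms by blast
  show ?thesis using assms(4,5) by simp
qed

section \<open>Elementwise description of \<open>\<lambda>\<close>-subcomplexes\<close>

definition labels_agree :: "nat \<Rightarrow> 'b \<Rightarrow> bool" where
  "labels_agree n x \<longleftrightarrow> (\<forall>i\<le>n. \<forall>\<alpha>\<in>\<Lambda> n i. \<forall>\<beta>\<in>\<Lambda> n i. d n i \<alpha> x = d n i \<beta> x)"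

text \<open>
  The identities are imposed for every choice of labels. On a family that is stable
  under the face maps and on which the labels agree, this is the same as the simplicial identities for the induced maps, but it can be
  stated for a single element, which the recursive construction of the greatest family requires.
\<close>
definition simplicial_at :: "nat \<Rightarrow> 'b \<Rightarrow> bool" where
  "simplicial_at n x \<longleftrightarrow> (2 \<le> n \<longrightarrow> (\<forall>i j. i < j \<longrightarrow> j \<le> n \<longrightarrow>
     (\<forall>\<alpha>\<in>\<Lambda> n j. \<forall>\<beta>\<in>\<Lambda> (n - 1) i. \<forall>\<gamma>\<in>\<Lambda> n i. \<forall>\<epsilon>\<in>\<Lambda> (n - 1) (j - 1).
       d (n - 1) i \<beta> (d n j \<alpha> x) = d (n - 1) (j - 1) \<epsilon> (d n i \<gamma> x))))"

lemma induced_face_apply: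
  assumes agree: "\<And>x. x \<in> A n \<Longrightarrow> labels_agree n x"
    and "1 \<le> n" "i \<le> n" "\<alpha> \<in> \<Lambda> n i"
  shows "induced_face \<Lambda> d A n i = restrict (d n i \<alpha>) (A n)"
proof (rule induced_face_eq[of n i \<alpha> \<Lambda>, OF assms(2-4)])
  fix \<beta> assume "\<beta> \<in> \<Lambda> n i"
  then have "d n i \<beta> x = d n i \<alpha> x" if "x \<in> A n" for x
    using agree[OF that] assms(3,4) unfolding labels_agree_def by blast
  then show "restrict (d n i \<beta>) (A n) = restrict (d n i \<alpha>) (A n)"
    by (rule restrict_ext)
qed

text \<open>
  The elementwise form of the definition, free of restrictions and of the choice hidden in
  \<^const>\<open>induced_face\<close>. It uses that the index sets are nonempty: a condition on an induced face is
  a condition on some, equivalently every, labelled map.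
\<close>
lemma lambda_subcomplex_iff:
  "lambda_subcomplex K \<Lambda> M d A \<longleftrightarrow>
    (\<forall>n. VectorSpace.subspace K (A n) (M n)) \<and>
    (\<forall>n\<ge>1. \<forall>x\<in>A n. labels_agree n x) \<and>
    (\<forall>n\<ge>1. \<forall>x\<in>A n. \<forall>i\<le>n. \<forall>\<alpha>\<in>\<Lambda> n i. d n i \<alpha> x \<in> A (n - 1)) \<and>
    (\<forall>n\<ge>1. \<forall>x\<in>A n. simplicial_at n x)"
proof -
  have agree_iff: "faces_agree \<Lambda> d A \<longleftrightarrow> (\<forall>n\<ge>1. \<forall>x\<in>A n. labels_agree n x)"
  proof -
    have "restrict f S = restrict g S \<longleftrightarrow> (\<forall>x\<in>S. f x = g x)" for f g :: "'b \<Rightarrow> 'b" and S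
      by (auto simp: restrict_def fun_eq_iff)
    then have agree: "faces_agree \<Lambda> d A \<longleftrightarrow> (\<forall>n i. 1 \<le> n \<longrightarrow> i \<le> n \<longrightarrow>
        (\<forall>\<alpha>\<in>\<Lambda> n i. \<forall>\<beta>\<in>\<Lambda> n i. \<forall>x\<in>A n. d n i \<alpha> x = d n i \<beta> x))"
      unfolding faces_agree_def by (simp only:)
    show ?thesis
    proof
      assume "faces_agree \<Lambda> d A"
      note this[unfolded agree, rule_format]
      then show "\<forall>n\<ge>1. \<forall>x\<in>A n. labels_agree n x"
        unfolding labels_agree_def by (intro allI impI ballI)
    next
      assume "\<forall>n\<ge>1. \<forall>x\<in>A n. labels_agree n x"
      note this[unfolded labels_agree_def, rule_format]
      then show "faces_agree \<Lambda> d A"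
        unfolding agree by (intro allI impI ballI)
    qed
  qed
  show ?thesis
  proof (cases "\<forall>n\<ge>1. \<forall>x\<in>A n. labels_agree n x")
    case False
    then show ?thesis
      unfolding lambda_subcomplex_def agree_iff by (simp only: simp_thms)
  next
    case True
    have ind: "induced_face \<Lambda> d A n i = restrict (d n i \<alpha>) (A n)"
      if "1 \<le> n" "i \<le> n" "\<alpha> \<in> \<Lambda> n i" for n i \<alpha>
      using True that by (intro induced_face_apply) auto
    have image_iff: "(\<forall>n i. 1 \<le> n \<longrightarrow> i \<le> n \<longrightarrow> induced_face \<Lambda> d A n i ` A n \<subseteq> A (n - 1)) \<longleftrightarrow>
        (\<forall>n\<ge>1. \<forall>x\<in>A n. \<forall>i\<le>n. \<forall>\<alpha>\<in>\<Lambda> n i. d n i \<alpha> x \<in> A (n - 1))" (is "?I \<longleftrightarrow> ?J")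
    proof
      assume ?I
      then show ?J using ind by (fastforce simp: image_subset_iff)
    next
      assume J: ?J
      show ?I
      proof (intro allI impI)
        fix n i :: nat assume n: "1 \<le> n" "i \<le> n"
        then obtain \<alpha> where "\<alpha> \<in> \<Lambda> n i" using index_nonempty by blast
        then show "induced_face \<Lambda> d A n i ` A n \<subseteq> A (n - 1)"
          using n J ind[OF n] by auto
      qed
    qed
    \<comment> \<open>Stability is needed here: the second face in a composite is restricted to the degree
      below, so its value is a labelled face only on elements of that subspace.\<close>
    have simp_iff: "(\<forall>n i j. 2 \<le> n \<longrightarrow> i < j \<longrightarrow> j \<le> n \<longrightarrow>
        (\<forall>x\<in>A n. induced_face \<Lambda> d A (n - 1) i (induced_face \<Lambda> d A n j x) =
                 induced_face \<Lambda> d A (n - 1) (j - 1) (induced_face \<Lambda> d A n i x))) \<longleftrightarrow>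
        (\<forall>n\<ge>1. \<forall>x\<in>A n. simplicial_at n x)" (is "?I \<longleftrightarrow> ?J") if closed:
        "\<forall>n\<ge>1. \<forall>x\<in>A n. \<forall>i\<le>n. \<forall>\<alpha>\<in>\<Lambda> n i. d n i \<alpha> x \<in> A (n - 1)"
    proof -
      have comp: "induced_face \<Lambda> d A (n - 1) i (induced_face \<Lambda> d A n j x)
          = d (n - 1) i \<beta> (d n j \<alpha> x)"
        if "2 \<le> n" "j \<le> n" "i \<le> n - 1" "x \<in> A n" "\<alpha> \<in> \<Lambda> n j" "\<beta> \<in> \<Lambda> (n - 1) i" for n i j x \<alpha> \<beta>
      proof -
        have "d n j \<alpha> x \<in> A (n - 1)" using closed that by simp
        then show ?thesis
          using that ind[of n j \<alpha>] ind[of "n - 1" i \<beta>] by simp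
      qed
      show ?thesis
      proof
        assume I: ?I
        show ?J
          unfolding simplicial_at_def
        proof (intro allI impI ballI)
          fix n x i j \<alpha> \<beta> \<gamma> \<epsilon>
          assume *: "x \<in> A n" "2 \<le> n" "i < j" "j \<le> n" "\<alpha> \<in> \<Lambda> n j" "\<beta> \<in> \<Lambda> (n - 1) i"
            "\<gamma> \<in> \<Lambda> n i" "\<epsilon> \<in> \<Lambda> (n - 1) (j - 1)"
          show "d (n - 1) i \<beta> (d n j \<alpha> x) = d (n - 1) (j - 1) \<epsilon> (d n i \<gamma> x)"
            using I * comp[of n j i x \<alpha> \<beta>] comp[of n i "j - 1" x \<gamma> \<epsilon>] by simp
        qed
      next
        assume J: ?J
        show ?I
        proof (intro allI impI ballI)
          fix n i j x
          assume *: "2 \<le> n" "i < j" "j \<le> n" "x \<in> A n"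
          obtain \<alpha> \<beta> \<gamma> \<epsilon> where l: "\<alpha> \<in> \<Lambda> n j" "\<beta> \<in> \<Lambda> (n - 1) i"
            "\<gamma> \<in> \<Lambda> n i" "\<epsilon> \<in> \<Lambda> (n - 1) (j - 1)"
            using * index_nonempty[of n j] index_nonempty[of "n - 1" i]
              index_nonempty[of n i] index_nonempty[of "n - 1" "j - 1"] by fastforce
          have "simplicial_at n x" using J * by simp
          then have "d (n - 1) i \<beta> (d n j \<alpha> x) = d (n - 1) (j - 1) \<epsilon> (d n i \<gamma> x)"
            using * l unfolding simplicial_at_def by blast
          then show "induced_face \<Lambda> d A (n - 1) i (induced_face \<Lambda> d A n j x) =
                 induced_face \<Lambda> d A (n - 1) (j - 1) (induced_face \<Lambda> d A n i x)"
            using * l comp[of n j i x \<alpha> \<beta>] comp[of n i "j - 1" x \<gamma> \<epsilon>] by simp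
        qed
      qed
    qed
    show ?thesis
      unfolding lambda_subcomplex_def agree_iff image_iff by (intro conj_cong refl simp_iff)
  qed
qed

section \<open>The greatest \<open>\<lambda>\<close>-subcomplex\<close>

primrec largest :: "nat \<Rightarrow> 'b set" where
  "largest 0 = carrier (M 0)"
| "largest (Suc n) = {x \<in> carrier (M (Suc n)). labels_agree (Suc n) x \<and> simplicial_at (Suc n) x \<and>
     (\<forall>i\<le>Suc n. \<forall>\<alpha>\<in>\<Lambda> (Suc n) i. d (Suc n) i \<alpha> x \<in> largest n)}"

text \<open>
  Both sides of each equation are a face map or a composite of two face maps, and such maps
  respect zero, sums and scalar multiples.
\<close>
lemma subspace_simplicial:
  assumes "1 \<le> n"
  shows "VectorSpace.subspace K {x \<in> carrier (M n). labels_agree n x \<and> simplicial_at n x} (M n)"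
proof -
  interpret vectorspace K "M n" by (rule space)
  have two_zero: "d (n - 1) i \<beta> (d n j \<alpha> \<zero>\<^bsub>M n\<^esub>) = \<zero>\<^bsub>M (n - 1 - 1)\<^esub>"
    and two_add: "\<lbrakk>x \<in> carrier (M n); y \<in> carrier (M n)\<rbrakk> \<Longrightarrow> d (n - 1) i \<beta> (d n j \<alpha> (x \<oplus>\<^bsub>M n\<^esub> y)) =
      d (n - 1) i \<beta> (d n j \<alpha> x) \<oplus>\<^bsub>M (n - 1 - 1)\<^esub> d (n - 1) i \<beta> (d n j \<alpha> y)"
    and two_smult: "\<lbrakk>c \<in> carrier K; x \<in> carrier (M n)\<rbrakk> \<Longrightarrow> d (n - 1) i \<beta> (d n j \<alpha> (c \<odot>\<^bsub>M n\<^esub> x)) =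
      c \<odot>\<^bsub>M (n - 1 - 1)\<^esub> d (n - 1) i \<beta> (d n j \<alpha> x)"
    if "2 \<le> n" "j \<le> n" "i \<le> n - 1" "\<alpha> \<in> \<Lambda> n j" "\<beta> \<in> \<Lambda> (n - 1) i" for i j \<alpha> \<beta> x y c
  proof -
    have n: "1 \<le> n - 1" using that(1) by simp
    note first = assms that(2,4) and second = n that(3,5)
    show "d (n - 1) i \<beta> (d n j \<alpha> \<zero>\<^bsub>M n\<^esub>) = \<zero>\<^bsub>M (n - 1 - 1)\<^esub>"
      by (simp only: face_zero[OF first] face_zero[OF second])
    show "d (n - 1) i \<beta> (d n j \<alpha> (x \<oplus>\<^bsub>M n\<^esub> y)) =
        d (n - 1) i \<beta> (d n j \<alpha> x) \<oplus>\<^bsub>M (n - 1 - 1)\<^esub> d (n - 1) i \<beta> (d n j \<alpha> y)"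
      if "x \<in> carrier (M n)" "y \<in> carrier (M n)"
      using that by (simp only: face_add[OF first] face_add[OF second] face_closed[OF first])
    show "d (n - 1) i \<beta> (d n j \<alpha> (c \<odot>\<^bsub>M n\<^esub> x)) =
        c \<odot>\<^bsub>M (n - 1 - 1)\<^esub> d (n - 1) i \<beta> (d n j \<alpha> x)"
      if "c \<in> carrier K" "x \<in> carrier (M n)"
      using that by (simp only: face_smult[OF first] face_smult[OF second] face_closed[OF first])
  qed
  have labels: "labels_agree n \<zero>\<^bsub>M n\<^esub>"
    "\<lbrakk>labels_agree n x; labels_agree n y; x \<in> carrier (M n); y \<in> carrier (M n)\<rbrakk>
      \<Longrightarrow> labels_agree n (x \<oplus>\<^bsub>M n\<^esub> y)"
    "\<lbrakk>labels_agree n x; c \<in> carrier K; x \<in> carrier (M n)\<rbrakk> \<Longrightarrow> labels_agree n (c \<odot>\<^bsub>M n\<^esub> x)"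
    for x y c
  proof -
    show "labels_agree n \<zero>\<^bsub>M n\<^esub>"
      using assms by (simp add: labels_agree_def face_zero)
    show "labels_agree n (x \<oplus>\<^bsub>M n\<^esub> y)"
      if "labels_agree n x" "labels_agree n y" "x \<in> carrier (M n)" "y \<in> carrier (M n)"
      unfolding labels_agree_def
    proof (intro allI impI ballI)
      fix i \<alpha> \<beta> assume *: "i \<le> n" "\<alpha> \<in> \<Lambda> n i" "\<beta> \<in> \<Lambda> n i"
      then have "d n i \<alpha> x = d n i \<beta> x" "d n i \<alpha> y = d n i \<beta> y"
        using that unfolding labels_agree_def by blast+
      then show "d n i \<alpha> (x \<oplus>\<^bsub>M n\<^esub> y) = d n i \<beta> (x \<oplus>\<^bsub>M n\<^esub> y)"
        by (simp only: face_add[OF assms *(1)] * that)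
    qed
    show "labels_agree n (c \<odot>\<^bsub>M n\<^esub> x)"
      if "labels_agree n x" "c \<in> carrier K" "x \<in> carrier (M n)"
      unfolding labels_agree_def
    proof (intro allI impI ballI)
      fix i \<alpha> \<beta> assume *: "i \<le> n" "\<alpha> \<in> \<Lambda> n i" "\<beta> \<in> \<Lambda> n i"
      then have "d n i \<alpha> x = d n i \<beta> x"
        using that unfolding labels_agree_def by blast
      then show "d n i \<alpha> (c \<odot>\<^bsub>M n\<^esub> x) = d n i \<beta> (c \<odot>\<^bsub>M n\<^esub> x)"
        by (simp only: face_smult[OF assms *(1)] * that)
    qed
  qed
  have simplicial: "simplicial_at n \<zero>\<^bsub>M n\<^esub>"
    "\<lbrakk>simplicial_at n x; simplicial_at n y; x \<in> carrier (M n); y \<in> carrier (M n)\<rbrakk>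
      \<Longrightarrow> simplicial_at n (x \<oplus>\<^bsub>M n\<^esub> y)"
    "\<lbrakk>simplicial_at n x; c \<in> carrier K; x \<in> carrier (M n)\<rbrakk> \<Longrightarrow> simplicial_at n (c \<odot>\<^bsub>M n\<^esub> x)"
    for x y c
  proof -
    have eq: "d (n - 1) i \<beta> (d n j \<alpha> z) = d (n - 1) (j - 1) \<epsilon> (d n i \<gamma> z)"
      if "simplicial_at n z" "2 \<le> n" "i < j" "j \<le> n"
        "\<alpha> \<in> \<Lambda> n j" "\<beta> \<in> \<Lambda> (n - 1) i" "\<gamma> \<in> \<Lambda> n i" "\<epsilon> \<in> \<Lambda> (n - 1) (j - 1)" for z i j \<alpha> \<beta> \<gamma> \<epsilon>
      using that unfolding simplicial_at_def by blast
    have bounds: "i \<le> n - 1" "i \<le> n" "j - 1 \<le> n - 1" if "i < j" "j \<le> n" for i j :: nat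
      using that by auto
    show "simplicial_at n \<zero>\<^bsub>M n\<^esub>"
      unfolding simplicial_at_def
    proof (intro allI impI ballI)
      fix i j \<alpha> \<beta> \<gamma> \<epsilon>
      assume *: "2 \<le> n" "i < j" "j \<le> n"
        "\<alpha> \<in> \<Lambda> n j" "\<beta> \<in> \<Lambda> (n - 1) i" "\<gamma> \<in> \<Lambda> n i" "\<epsilon> \<in> \<Lambda> (n - 1) (j - 1)"
      show "d (n - 1) i \<beta> (d n j \<alpha> \<zero>\<^bsub>M n\<^esub>) = d (n - 1) (j - 1) \<epsilon> (d n i \<gamma> \<zero>\<^bsub>M n\<^esub>)"
        by (simp only: two_zero bounds[OF *(2,3)] *)
    qed
    show "simplicial_at n (x \<oplus>\<^bsub>M n\<^esub> y)"
      if "simplicial_at n x" "simplicial_at n y" "x \<in> carrier (M n)" "y \<in> carrier (M n)"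
      unfolding simplicial_at_def
    proof (intro allI impI ballI)
      fix i j \<alpha> \<beta> \<gamma> \<epsilon>
      assume *: "2 \<le> n" "i < j" "j \<le> n"
        "\<alpha> \<in> \<Lambda> n j" "\<beta> \<in> \<Lambda> (n - 1) i" "\<gamma> \<in> \<Lambda> n i" "\<epsilon> \<in> \<Lambda> (n - 1) (j - 1)"
      show "d (n - 1) i \<beta> (d n j \<alpha> (x \<oplus>\<^bsub>M n\<^esub> y)) = d (n - 1) (j - 1) \<epsilon> (d n i \<gamma> (x \<oplus>\<^bsub>M n\<^esub> y))"
        by (simp only: two_add that bounds[OF *(2,3)] *
            eq[OF that(1) *] eq[OF that(2) *])
    qed
    show "simplicial_at n (c \<odot>\<^bsub>M n\<^esub> x)"
      if "simplicial_at n x" "c \<in> carrier K" "x \<in> carrier (M n)"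
      unfolding simplicial_at_def
    proof (intro allI impI ballI)
      fix i j \<alpha> \<beta> \<gamma> \<epsilon>
      assume *: "2 \<le> n" "i < j" "j \<le> n"
        "\<alpha> \<in> \<Lambda> n j" "\<beta> \<in> \<Lambda> (n - 1) i" "\<gamma> \<in> \<Lambda> n i" "\<epsilon> \<in> \<Lambda> (n - 1) (j - 1)"
      show "d (n - 1) i \<beta> (d n j \<alpha> (c \<odot>\<^bsub>M n\<^esub> x)) = d (n - 1) (j - 1) \<epsilon> (d n i \<gamma> (c \<odot>\<^bsub>M n\<^esub> x))"
        by (simp only: two_smult that bounds[OF *(2,3)] * eq[OF that(1) *])
    qed
  qed
  show ?thesis
    using labels simplicial by unfold_locales auto
qed

text \<open>
  In degree \<open>n + 1\<close> the space is cut out by equations between linear maps and by preimages of the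
  subspace \<open>largest n\<close>.
\<close>
lemma subspace_largest: "VectorSpace.subspace K (largest n) (M n)"
proof (induction n)
  case 0
  show ?case using subspace_carrier[OF space] by simp
next
  case (Suc n)
  interpret vectorspace K "M (Suc n)" by (rule space)
  interpret L: LinearCombinations.submodule K "largest n" "M n"
    using Suc.IH by (simp add: VectorSpace.subspace_def)
  interpret E: LinearCombinations.submodule K
    "{x \<in> carrier (M (Suc n)). labels_agree (Suc n) x \<and> simplicial_at (Suc n) x}" "M (Suc n)"
    using subspace_simplicial[of "Suc n"] by (simp add: VectorSpace.subspace_def)
  note face_linear = face_zero[of "Suc n"] face_add[of "Suc n"] face_smult[of "Suc n"]
  show ?case
    using E.zero_closed E.m_closed E.smult_closed
    by unfold_locales (auto simp: face_linear[simplified])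
qed

lemma lambda_subcomplex_largest: "lambda_subcomplex K \<Lambda> M d largest"
  unfolding lambda_subcomplex_iff
proof (intro conjI allI impI ballI)
  fix n :: nat assume "1 \<le> n"
  then obtain m where n: "n = Suc m" by (cases n) auto
  fix x assume "x \<in> largest n"
  then show "labels_agree n x" "simplicial_at n x"
    by (auto simp: n)
  fix i \<alpha> assume "i \<le> n" "\<alpha> \<in> \<Lambda> n i"
  then show "d n i \<alpha> x \<in> largest (n - 1)"
    using \<open>x \<in> largest n\<close> by (simp add: n)
qed (rule subspace_largest)

text \<open>
  The faces of an element of degree \<open>n + 1\<close> have degree \<open>n\<close>, so induction on the degree puts them
  into \<^const>\<open>largest\<close>; the remaining conditions hold in every \<open>\<lambda>\<close>-subcomplex.
\<close>
lemma lambda_subcomplex_le_largest: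
  assumes A: "lambda_subcomplex K \<Lambda> M d A"
  shows "A \<le> largest"
proof (rule le_funI)
  have carrier: "A n \<subseteq> carrier (M n)" for n
    using A by (simp add: lambda_subcomplex_def VectorSpace.subspace_def
        LinearCombinations.submodule_def)
  fix n show "A n \<subseteq> largest n"
  proof (induction n)
    case 0
    show ?case using carrier by simp
  next
    case (Suc n)
    have "\<forall>x\<in>A (Suc n). labels_agree (Suc n) x \<and> simplicial_at (Suc n) x \<and>
        (\<forall>i\<le>Suc n. \<forall>\<alpha>\<in>\<Lambda> (Suc n) i. d (Suc n) i \<alpha> x \<in> A n)"
      using A unfolding lambda_subcomplex_iff
      by (metis diff_Suc_1 le_add1 plus_1_eq_Suc)
    then show ?case using Suc.IH carrier[of "Suc n"] by auto
  qed
qed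

lemma maximal_lambda_subcomplex_iff:
  "maximal_lambda_subcomplex K \<Lambda> M d A \<longleftrightarrow> A = largest"
proof
  assume max: "maximal_lambda_subcomplex K \<Lambda> M d A"
  then have "A \<le> largest"
    by (intro lambda_subcomplex_le_largest) (simp add: maximal_lambda_subcomplex_def)
  then show "A = largest"
    using max lambda_subcomplex_largest unfolding maximal_lambda_subcomplex_def by blast
next
  assume "A = largest"
  then show "maximal_lambda_subcomplex K \<Lambda> M d A"
    using lambda_subcomplex_largest
    by (auto simp: maximal_lambda_subcomplex_def intro: order_antisym lambda_subcomplex_le_largest)
qed

section \<open>Pre-simplicial modules in the system\<close>

text \<open>
  The labelled maps determine the face maps of a pre-simplicial module in the system, because
  every index set has an element; conversely the induced maps are linear and satisfy the
  simplicial identities.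
\<close>
lemma pre_simplicial_in_iff:
  "pre_simplicial_in K \<Lambda> M d (X, \<delta>) \<longleftrightarrow>
    lambda_subcomplex K \<Lambda> M d X \<and> \<delta> = induced_face \<Lambda> d X"
proof
  assume P: "pre_simplicial_in K \<Lambda> M d (X, \<delta>)"
  then interpret X: pre_simplicial_module K "\<lambda>n. (M n)\<lparr>carrier := X n\<rparr>" \<delta>
    by (simp add: pre_simplicial_in_def)
  have sub: "VectorSpace.subspace K (X n) (M n)" for n
    using P by (simp add: pre_simplicial_in_def)
  have \<delta>: "\<delta> n i = restrict (d n i \<alpha>) (X n)" if "1 \<le> n" "i \<le> n" "\<alpha> \<in> \<Lambda> n i" for n i \<alpha>
    using P that by (simp add: pre_simplicial_in_def)
  have unused: "\<delta> n i = (\<lambda>x. undefined)" if "\<not> (1 \<le> n \<and> i \<le> n)" for n i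
    using P that unfolding pre_simplicial_in_def by blast
  have eq: "\<delta> = induced_face \<Lambda> d X"
  proof (intro ext[of \<delta>] ext[of "\<delta> _"])
    fix n i
    show "\<delta> n i = induced_face \<Lambda> d X n i"
    proof (cases "1 \<le> n \<and> i \<le> n")
      case True
      then obtain \<alpha> where "\<alpha> \<in> \<Lambda> n i" using index_nonempty by blast
      then have "induced_face \<Lambda> d X n i = \<delta> n i"
        using True \<delta>[of n i, symmetric] by (intro induced_face_eq[of n i \<alpha> \<Lambda>]) auto
      then show ?thesis by simp
    next
      case False
      then show ?thesis using unused by (auto simp: induced_face_def)
    qed
  qed
  have closed: "\<delta> n i x \<in> X (n - 1)" if "1 \<le> n" "i \<le> n" "x \<in> X n" for n i x
  proof -
    interpret VectorSpace.linear_map K "(M n)\<lparr>carrier := X n\<rparr>"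
      "(M (n - 1))\<lparr>carrier := X (n - 1)\<rparr>" "\<delta> n i"
      using X.face that by blast
    show ?thesis using f_im[of x] that by simp
  qed
  have "faces_agree \<Lambda> d X"
    unfolding faces_agree_def using \<delta> by metis
  then have "lambda_subcomplex K \<Lambda> M d X"
    unfolding lambda_subcomplex_def eq[symmetric]
    using sub closed X.simplicial by auto
  then show "lambda_subcomplex K \<Lambda> M d X \<and> \<delta> = induced_face \<Lambda> d X"
    using eq by simp
next
  assume "lambda_subcomplex K \<Lambda> M d X \<and> \<delta> = induced_face \<Lambda> d X"
  then have X: "lambda_subcomplex K \<Lambda> M d X" and \<delta>: "\<delta> = induced_face \<Lambda> d X" by auto
  have sub: "VectorSpace.subspace K (X n) (M n)" for n
    using X by (simp add: lambda_subcomplex_def)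
  have ind: "\<delta> n i = restrict (d n i \<alpha>) (X n)" if "1 \<le> n" "i \<le> n" "\<alpha> \<in> \<Lambda> n i" for n i \<alpha>
    unfolding \<delta> using X that unfolding lambda_subcomplex_iff
    by (intro induced_face_apply) auto
  have "pre_simplicial_module K (\<lambda>n. (M n)\<lparr>carrier := X n\<rparr>) \<delta>"
  proof (rule pre_simplicial_module.intro)
    show "vectorspace K ((M n)\<lparr>carrier := X n\<rparr>)" for n
      using vectorspace.subspace_is_vs[OF space sub] .
  next
    fix n i :: nat assume n: "1 \<le> n" "i \<le> n"
    then obtain \<alpha> where \<alpha>: "\<alpha> \<in> \<Lambda> n i" using index_nonempty by blast
    have "d n i \<alpha> x \<in> X (n - 1)" if "x \<in> X n" for x
      using X n \<alpha> that unfolding lambda_subcomplex_iff by blast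
    then show "VectorSpace.linear_map K ((M n)\<lparr>carrier := X n\<rparr>)
        ((M (n - 1))\<lparr>carrier := X (n - 1)\<rparr>) (\<delta> n i)"
      unfolding ind[OF n \<alpha>] using face[OF n \<alpha>] sub by (intro linear_map_restrict)
  next
    fix n i j x
    assume "2 \<le> n" "i < j" "j \<le> n" "x \<in> carrier ((M n)\<lparr>carrier := X n\<rparr>)"
    then show "\<delta> (n - 1) i (\<delta> n j x) = \<delta> (n - 1) (j - 1) (\<delta> n i x)"
      using X by (simp add: \<delta> lambda_subcomplex_def)
  qed
  then show "pre_simplicial_in K \<Lambda> M d (X, \<delta>)"
    unfolding pre_simplicial_in_def using sub ind by (auto simp: \<delta> induced_face_def)
qed

text \<open>
  Containment of pre-simplicial modules also asks that the face maps be compatible; between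
  \<open>\<lambda>\<close>-subcomplexes this is automatic, since both induced maps restrict the same labelled map.
\<close>
lemma sub_pre_simplicial_induced_face:
  assumes A: "lambda_subcomplex K \<Lambda> M d A" and B: "lambda_subcomplex K \<Lambda> M d B" and "A \<le> B"
  shows "sub_pre_simplicial (A, induced_face \<Lambda> d A) (B, induced_face \<Lambda> d B)"
proof -
  have "induced_face \<Lambda> d A n i x = induced_face \<Lambda> d B n i x"
    if n: "1 \<le> n" "i \<le> n" and x: "x \<in> A n" for n i x
  proof -
    obtain \<alpha> where \<alpha>: "\<alpha> \<in> \<Lambda> n i" using index_nonempty n by blast
    have "x \<in> B n" using \<open>A \<le> B\<close> x by (auto simp: le_fun_def)
    moreover have "induced_face \<Lambda> d A n i = restrict (d n i \<alpha>) (A n)"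
      using A n \<alpha> unfolding lambda_subcomplex_iff by (intro induced_face_apply) auto
    moreover have "induced_face \<Lambda> d B n i = restrict (d n i \<alpha>) (B n)"
      using B n \<alpha> unfolding lambda_subcomplex_iff by (intro induced_face_apply) auto
    ultimately show ?thesis using x by simp
  qed
  then show ?thesis using \<open>A \<le> B\<close> by (simp add: sub_pre_simplicial_def)
qed

lemma maximal_pre_simplicial_in_iff:
  "maximal_pre_simplicial_in K \<Lambda> M d P \<longleftrightarrow> P = (largest, induced_face \<Lambda> d largest)"
proof
  obtain X \<delta> where P_def: "P = (X, \<delta>)" by (cases P)
  assume max: "maximal_pre_simplicial_in K \<Lambda> M d P"
  then have X: "lambda_subcomplex K \<Lambda> M d X" and \<delta>: "\<delta> = induced_face \<Lambda> d X"
    by (auto simp: maximal_pre_simplicial_in_def P_def pre_simplicial_in_iff)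
  have "sub_pre_simplicial P (largest, induced_face \<Lambda> d largest)"
    unfolding P_def \<delta> using X lambda_subcomplex_largest lambda_subcomplex_le_largest[OF X]
    by (rule sub_pre_simplicial_induced_face)
  moreover have "pre_simplicial_in K \<Lambda> M d (largest, induced_face \<Lambda> d largest)"
    using lambda_subcomplex_largest by (simp add: pre_simplicial_in_iff)
  ultimately show "P = (largest, induced_face \<Lambda> d largest)"
    using max unfolding maximal_pre_simplicial_in_def by metis
next
  assume P: "P = (largest, induced_face \<Lambda> d largest)"
  show "maximal_pre_simplicial_in K \<Lambda> M d P"
    unfolding maximal_pre_simplicial_in_def
  proof (intro conjI allI impI)
    show "pre_simplicial_in K \<Lambda> M d P"
      using lambda_subcomplex_largest by (simp add: P pre_simplicial_in_iff)
  next
    fix Q assume Q: "pre_simplicial_in K \<Lambda> M d Q" and PQ: "sub_pre_simplicial P Q"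
    obtain Y \<epsilon> where Q_def: "Q = (Y, \<epsilon>)" by (cases Q)
    have Y: "lambda_subcomplex K \<Lambda> M d Y" "\<epsilon> = induced_face \<Lambda> d Y"
      using Q by (auto simp: Q_def pre_simplicial_in_iff)
    have "largest \<le> Y" using PQ by (simp add: P Q_def sub_pre_simplicial_def)
    then have "Y = largest" using lambda_subcomplex_le_largest[OF Y(1)] by (rule order_antisym[rotated])
    then show "Q = P" using Y by (simp add: P Q_def)
  qed
qed

end

theorem theorem3p6:
  fixes K :: "('a, 'r) ring_scheme"
    and \<Lambda> :: "nat \<Rightarrow> nat \<Rightarrow> 'i set"
    and M :: "nat \<Rightarrow> ('a, 'b, 'm) module_scheme"
    and d :: "nat \<Rightarrow> nat \<Rightarrow> 'i \<Rightarrow> 'b \<Rightarrow> 'b"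
  assumes "field K"
    and "Delta_indexing_set \<Lambda>"
    and "Lambda_system K \<Lambda> M d"
  shows "(\<exists>!A. maximal_lambda_subcomplex K \<Lambda> M d A) \<and>
    (\<exists>!P. maximal_pre_simplicial_in K \<Lambda> M d P) \<and>
    (\<forall>A. maximal_lambda_subcomplex K \<Lambda> M d A \<longrightarrow> Theta K \<Lambda> M d = (A, induced_face \<Lambda> d A))"
proof -
  interpret Lambda_system K \<Lambda> M d by fact
  show ?thesis
    unfolding Theta_def maximal_lambda_subcomplex_iff maximal_pre_simplicial_in_iff by simp
qed

end
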